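(* Let $1\le k\le n$ and $\mu>0$. The average execution time $T_{\rm avg}=\mathbb{E}[T]$ of any linear-coded distributed computing system with $n$ servers and straggling parameter $\mu$, using an $(n,k)$ linear code with full-rank generator matrix and an underlying decoder (which succeeds when no symbol is erased), can be expressed as $$T_{\rm avg}=\frac{1}{k}\left[1+\sum_{i=n-k+1}^{n}\frac{1}{i\mu}\right]+\frac{1}{\mu k}\sum_{i=1}^{n-k}\frac{1}{i}\,p(i,k),$$ where $p(i,k)$ is the average conditional probability of decoding failure, for the underlying decoder, given that $i$ encoded symbols are erased at random.
   Context: System model. A computational job is divided equally into $k$ tasks, encoded by an $(n,k)$ linear code into $n$ encoded tasks, and the $j$-th encoded task is assigned to the $j$-th of $n$ servers. The run times $T_1,\dots,T_n$ of the servers are i.i.d. with shifted-exponential distribution $\Pr(T_i\le t)=1-\exp(-\mu(kt-1))$ for $t\ge 1/k$, and $\Pr(T_i\le t)=0$ for $t<1/k$. An encoded task not completed by time $t$ is regarded as erased. Decodability. The code together with its decoder over erasure channels determines which sets $S\subseteq\{1,\dots,n\}$ of unerased encoded symbols are decodable, i.e. lead to successful decoding with probability $1$. A set of fewer than $k$ unerased symbols is never decodable, and any set containing a decodable set is decodable. The total job completion time $T$ is the first time $t$ at which the set $\{i: T_i\le t\}$ is decodable. For $0\le i\le n$, $p(i,k)$ is the probability that decoding fails, i.e. that the set of unerased symbols is not decodable, when the set of erased symbols is a uniformly random subset of $\{1,\dots,n\}$ of size $i$. In particular the assumption that decoding succeeds with no erasures means $p(0,k)=0$. *)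

theory Defs
  imports "HOL-Probability.Probability" "Jordan_Normal_Form.DL_Rank"
begin

(* Encoded symbols and servers are numbered 0, ..., n - 1, as JNF vector coordinates are.
   The code is the row space of a k x n matrix G: a message m, a vector of length k, is
   encoded as m G, written below as the column vector (transpose G) m. *)

definition codeword :: "'f :: field mat \<Rightarrow> 'f Matrix.vec \<Rightarrow> 'f Matrix.vec" where
  "codeword G m = transpose_mat G *\<^sub>v m"

definition erasure_output :: "nat set \<Rightarrow> 'f Matrix.vec \<Rightarrow> nat \<Rightarrow> 'f option" where
  "erasure_output S c = (\<lambda>j. if j \<in> S then Some (vec_index c j) else None)"

(* A decoder may use internal randomness, modelled by a probability space R. It maps an outcome
   r of R and the output of the erasure channel to an estimate of the message, or to None.
   It need not be an optimal decoder. *)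

type_synonym ('r, 'f) decoder = "'r \<Rightarrow> (nat \<Rightarrow> 'f option) \<Rightarrow> 'f Matrix.vec option"

definition decodable ::
  "'r measure \<Rightarrow> ('r, 'f) decoder \<Rightarrow> 'f :: field mat \<Rightarrow> nat set \<Rightarrow> bool" where
  "decodable R dec G S \<longleftrightarrow>
     (\<forall>m \<in> carrier_vec (dim_row G).
        AE r in R. dec r (erasure_output S (codeword G m)) = Some m)"

definition failure_prob ::
  "'r measure \<Rightarrow> ('r, 'f) decoder \<Rightarrow> 'f :: field mat \<Rightarrow> nat \<Rightarrow> real" where
  "failure_prob R dec G i =
     measure_pmf.prob (pmf_of_set {E. E \<subseteq> {..<dim_col G} \<and> card E = i})
       {E. \<not> decodable R dec G ({..<dim_col G} - E)}"

(* The set of times in question contains the largest run time if the full set is decodable.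
   If moreover the empty set is not decodable, the set of times has a least element. *)

definition completion_time ::
  "'r measure \<Rightarrow> ('r, 'f) decoder \<Rightarrow> 'f :: field mat \<Rightarrow> (nat \<Rightarrow> 'a \<Rightarrow> real) \<Rightarrow> 'a \<Rightarrow> real" where
  "completion_time R dec G X \<omega> =
     (LEAST t. decodable R dec G {j \<in> {..<dim_col G}. X j \<omega> \<le> t})"

end

(* A set of fewer than k symbols cannot be decoded: some nonzero message is encoded with zeros
   there, so it is indistinguishable from the zero message. Hence p(i,k) = 1 for i > n - k, and the
   claim becomes E[T] = 1/k + (1/(mu k)) * sum_{i=1..n} p(i,k)/i. The variable Y = mu (k T - 1) is
   nonnegative almost surely, and Y > u iff the set E of servers still running at time
   (1 + u/mu)/k is one whose erasure makes decoding fail; a given E occurs with probability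
   e^{-|E|u} (1 - e^{-u})^{n-|E|}. Integrating over u >= 0 gives a Beta integral, which
   contributes 1/(i binom(n,i)) for each such E of size i. *)

theory Submission
  imports Defs
begin

section \<open>Integrals: a Beta integral and the layer-cake formula\<close>

text \<open>With x = exp (- u) this is the Beta integral of x^i (1 - x)^m over [0, 1]; the extra
  factor in \<open>Suc i\<close> comes from dx. Writing (1 - x)^(m+1) as (1 - x)^m - x (1 - x)^m
  raises the exponent of x, so the induction on \<open>m\<close> needs arbitrary
  \<open>i\<close>.\<close>

lemma has_bochner_integral_exp_times_one_minus_exp_power:
  "has_bochner_integral lborel
     (\<lambda>u::real. indicator {0..} u * (exp (- u) ^ Suc i * (1 - exp (- u)) ^ m))
     (fact i * fact m / fact (Suc (i + m)))"
proof (induction m arbitrary: i)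
  case 0
  have "(\<integral>\<^sup>+ u. ennreal (exp (- (real (Suc i) * u))) * indicator {0..} u \<partial>lborel)
      = ennreal (0 - (- exp (- (real (Suc i) * 0)) / real (Suc i)))"
  proof (rule nn_integral_FTC_atLeast)
    show "((\<lambda>u. - exp (- (real (Suc i) * u)) / real (Suc i)) \<longlongrightarrow> 0) at_top"
      by real_asymp
  qed (auto intro!: derivative_eq_intros simp del: of_nat_Suc)
  also have "\<dots> = ennreal (1 / real (Suc i))"
    by simp
  finally have "has_bochner_integral lborel
      (\<lambda>u. exp (- (real (Suc i) * u)) * indicator {0..} u) (1 / real (Suc i))"
    by (intro has_bochner_integral_nn_integral)
      (auto simp: nn_integral_set_ennreal split: split_indicator)
  moreover have "exp (- (real (Suc i) * u)) = exp (- u) ^ Suc i" for u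
    by (metis exp_of_nat_mult mult_minus_right)
  moreover have "(fact i * fact 0 / fact (Suc (i + 0)) :: real) = 1 / real (Suc i)"
    by (simp del: of_nat_Suc)
  ultimately show ?case
    by (simp add: mult.commute del: power_Suc of_nat_Suc)
next
  case (Suc m)
  \<comment> \<open>The Beta recurrence B(a, b+1) = B(a, b) - B(a+1, b) at a = i + 1, b = m +
    1.\<close>
  have *: "(fact i * fact m / fact (Suc (i + m)) - fact (Suc i) * fact m / fact (Suc (Suc i + m)) :: real)
      = fact i * fact (Suc m) / fact (Suc (i + Suc m))"
    by (simp add: divide_simps) (simp add: algebra_simps)
  have "(\<lambda>u::real. indicator {0..} u * (exp (- u) ^ Suc i * (1 - exp (- u)) ^ Suc m)) =
      (\<lambda>u. indicator {0..} u * (exp (- u) ^ Suc i * (1 - exp (- u)) ^ m)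
         - indicator {0..} u * (exp (- u) ^ Suc (Suc i) * (1 - exp (- u)) ^ m))"
    by (simp add: fun_eq_iff algebra_simps)
  with has_bochner_integral_diff[OF Suc.IH[of i] Suc.IH[of "Suc i"]] show ?case
    unfolding * by (simp del: power_Suc fact_Suc)
qed

text \<open>The positive part of Y x is the length of [0, Y x); Tonelli then exchanges the two
  integrals over the region 0 \<le> u < Y x. Negative values of \<open>Y\<close> count as 0 on both
  sides.\<close>

lemma (in sigma_finite_measure) nn_integral_eq_nn_integral_tail:
  fixes Y :: "'a \<Rightarrow> real"
  assumes [measurable]: "Y \<in> borel_measurable M"
  shows "(\<integral>\<^sup>+ x. ennreal (Y x) \<partial>M) =
    (\<integral>\<^sup>+ u. indicator {0..} u * emeasure M {x \<in> space M. u < Y x} \<partial>lborel)"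
proof -
  interpret pair_sigma_finite M lborel ..
  have "(\<integral>\<^sup>+ x. ennreal (Y x) \<partial>M) =
      (\<integral>\<^sup>+ x. (\<integral>\<^sup>+ u. indicator {p \<in> space (M \<Otimes>\<^sub>M lborel). 0 \<le> snd p \<and> snd p < Y (fst p)} (x, u) \<partial>lborel) \<partial>M)"
  proof (rule nn_integral_cong)
    fix x assume "x \<in> space M"
    then have "(\<integral>\<^sup>+ u. indicator {p \<in> space (M \<Otimes>\<^sub>M lborel). 0 \<le> snd p \<and> snd p < Y (fst p)} (x, u) \<partial>lborel)
        = (\<integral>\<^sup>+ u. indicator {0..<Y x} u \<partial>lborel)"
      by (intro nn_integral_cong) (auto simp: space_pair_measure split: split_indicator)
    also have "\<dots> = ennreal (Y x)"
      by (cases "0 \<le> Y x") (auto simp: ennreal_neg)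
    finally show "ennreal (Y x) = (\<integral>\<^sup>+ u. indicator {p \<in> space (M \<Otimes>\<^sub>M lborel). 0 \<le> snd p \<and> snd p < Y (fst p)} (x, u) \<partial>lborel)" ..
  qed
  also have "\<dots> = (\<integral>\<^sup>+ u. (\<integral>\<^sup>+ x. indicator {p \<in> space (M \<Otimes>\<^sub>M lborel). 0 \<le> snd p \<and> snd p < Y (fst p)} (x, u) \<partial>M) \<partial>lborel)"
    by (rule Fubini'[symmetric]) measurable
  also have "\<dots> = (\<integral>\<^sup>+ u. indicator {0..} u * emeasure M {x \<in> space M. u < Y x} \<partial>lborel)"
  proof (rule nn_integral_cong)
    fix u :: real
    have "(\<integral>\<^sup>+ x. indicator {p \<in> space (M \<Otimes>\<^sub>M lborel). 0 \<le> snd p \<and> snd p < Y (fst p)} (x, u) \<partial>M)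
        = (\<integral>\<^sup>+ x. indicator {0..} u * indicator {x \<in> space M. u < Y x} x \<partial>M)"
      by (intro nn_integral_cong) (auto simp: space_pair_measure split: split_indicator)
    also have "\<dots> = indicator {0..} u * emeasure M {x \<in> space M. u < Y x}"
      by (simp add: nn_integral_cmult)
    finally show "(\<integral>\<^sup>+ x. indicator {p \<in> space (M \<Otimes>\<^sub>M lborel). 0 \<le> snd p \<and> snd p < Y (fst p)} (x, u) \<partial>M)
        = indicator {0..} u * emeasure M {x \<in> space M. u < Y x}" .
  qed
  finally show ?thesis .
qed

section \<open>The completion time as an attained minimum\<close>

text \<open>\<open>LEAST\<close> on the reals says nothing unless a minimum exists. It does here,
  because the sublevel set changes only at the finitely many values of \<open>x\<close>;
  monotonicity of \<open>D\<close> then carries success at the minimum to all later t.\<close>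

lemma Least_le_iff_sublevel:
  fixes x :: "'i \<Rightarrow> real"
  assumes "finite I" "D I" "\<not> D {}"
    and mono: "\<And>S S'. \<lbrakk>S \<subseteq> S'; S' \<subseteq> I; D S\<rbrakk> \<Longrightarrow> D S'"
  shows "(LEAST t. D {j \<in> I. x j \<le> t}) \<le> t \<longleftrightarrow> D {j \<in> I. x j \<le> t}"
proof -
  \<comment> \<open>Lowering t to the largest value of \<open>x\<close> not above it leaves the
    sublevel set unchanged. Such a value exists because \<open>D {}\<close> fails.\<close>
  have attained: "\<exists>s \<in> x ` I. s \<le> t \<and> D {j \<in> I. x j \<le> s}" if "D {j \<in> I. x j \<le> t}" for t
  proof -
    let ?J = "{j \<in> I. x j \<le> t}"
    have J: "finite ?J" "?J \<noteq> {}"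
      using \<open>finite I\<close> \<open>\<not> D {}\<close> that by (auto simp del: Collect_empty_eq)
    then have m: "Max (x ` ?J) \<in> x ` ?J"
      by (intro Max_in) auto
    have "?J = {j \<in> I. x j \<le> Max (x ` ?J)}"
    proof (intro equalityI subsetI)
      fix j assume "j \<in> ?J"
      then show "j \<in> {j \<in> I. x j \<le> Max (x ` ?J)}"
        using J by auto
    next
      fix j assume "j \<in> {j \<in> I. x j \<le> Max (x ` ?J)}"
      then show "j \<in> ?J"
        using m by auto
    qed
    with m that show ?thesis
      by (intro bexI[of _ "Max (x ` ?J)"]) auto
  qed
  \<comment> \<open>The finite set of successful values of \<open>x\<close>; its minimum is the
    required least time.\<close>
  define V where "V = {s \<in> x ` I. D {j \<in> I. x j \<le> s}}"
  have "I \<noteq> {}"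
    using assms by auto
  have "{j \<in> I. x j \<le> Max (x ` I)} = I"
    using \<open>finite I\<close> by auto
  then have "D {j \<in> I. x j \<le> Max (x ` I)}"
    using \<open>D I\<close> by simp
  then have V: "finite V" "V \<noteq> {}"
    using attained \<open>finite I\<close> by (auto simp: V_def)
  have least: "(LEAST t. D {j \<in> I. x j \<le> t}) = Min V"
  proof (rule Least_equality)
    show "D {j \<in> I. x j \<le> Min V}"
      using Min_in[OF V] by (simp add: V_def)
    fix t assume "D {j \<in> I. x j \<le> t}"
    then obtain s where "s \<in> V" "s \<le> t"
      using attained unfolding V_def by blast
    then show "Min V \<le> t"
      using V Min_le order_trans by blast
  qed
  show ?thesis
  proof
    assume "(LEAST t. D {j \<in> I. x j \<le> t}) \<le> t"
    then have "{j \<in> I. x j \<le> Min V} \<subseteq> {j \<in> I. x j \<le> t}"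
      using least by auto
    then show "D {j \<in> I. x j \<le> t}"
      by (rule mono) (use Min_in[OF V] in \<open>simp_all add: V_def\<close>)
  next
    assume "D {j \<in> I. x j \<le> t}"
    then obtain s where "s \<in> V" "s \<le> t"
      using attained unfolding V_def by blast
    then show "(LEAST t. D {j \<in> I. x j \<le> t}) \<le> t"
      unfolding least using V Min_le order_trans by blast
  qed
qed

section \<open>Fewer than k symbols are never decodable\<close>

text \<open>Reading only the coordinates in \<open>S\<close> is a linear map from dimension
  \<open>k\<close> to a smaller dimension, so its kernel is nontrivial. The kernel vector is
  obtained from a singular square matrix.\<close>

lemma exists_nonzero_message_vanishing_on:
  fixes G :: "'f :: field mat"
  assumes G: "G \<in> carrier_mat k n" and S: "S \<subseteq> {..<n}" "card S < k"
  obtains m where "m \<in> carrier_vec k" "m \<noteq> 0\<^sub>v k" "\<And>j. j \<in> S \<Longrightarrow> codeword G m $ j = 0"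
proof -
  have "finite S"
    using S finite_subset by blast
  then obtain h where h: "bij_betw h {..<card S} S"
    using ex_bij_betw_nat_finite[of S] by (auto simp: atLeast0LessThan)
  \<comment> \<open>The columns of \<open>G\<close> indexed by \<open>S\<close> become rows, padded
    with zero rows to a square matrix.\<close>
  define A where "A = mat k k (\<lambda>(i, l). if i < card S then G $$ (l, h i) else 0)"
  have A: "A \<in> carrier_mat k k"
    by (simp add: A_def)
  \<comment> \<open>Row \<open>card S\<close> of \<open>A\<close> is the first padding row; it
    exists since \<open>card S < k\<close>, and it makes \<open>A\<close> singular.\<close>
  have "transpose_mat A *\<^sub>v unit_vec k (card S) = 0\<^sub>v k"
    using S by (auto simp: A_def intro!: eq_vecI)
  moreover have "unit_vec k (card S) \<noteq> (0\<^sub>v k :: 'f Matrix.vec)"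
    using S by simp
  ultimately have "det (transpose_mat A) = 0"
    using A
    by (subst det_0_iff_vec_prod_zero_field[of _ k])
      (auto intro!: exI[of _ "unit_vec k (card S)"])
  then have "det A = 0"
    using A by (simp add: det_transpose)
  then obtain m where m: "m \<in> carrier_vec k" "m \<noteq> 0\<^sub>v k" "A *\<^sub>v m = 0\<^sub>v k"
    using det_0_iff_vec_prod_zero_field[OF A] by auto
  have "codeword G m $ j = 0" if j: "j \<in> S" for j
  proof -
    have "j < n"
      using j S by auto
    obtain i where i: "i < card S" "j = h i"
      using j bij_betw_imp_surj_on[OF h] by auto
    have "(A *\<^sub>v m) $ i = 0"
      using m(3) i S by simp
    moreover have "row A i = col G j"
      using i S G \<open>j < n\<close> by (auto simp: A_def intro!: eq_vecI)
    ultimately show ?thesis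
      using i S A G \<open>j < n\<close> by (simp add: codeword_def)
  qed
  with m that show thesis
    by blast
qed

lemma not_decodable_if_card_less:
  fixes G :: "'f :: field mat"
  assumes R: "prob_space R" and G: "G \<in> carrier_mat k n" and S: "S \<subseteq> {..<n}" "card S < k"
  shows "\<not> decodable R dec G S"
proof
  assume dec: "decodable R dec G S"
  interpret R: prob_space R by fact
  obtain m where m: "m \<in> carrier_vec k" "m \<noteq> 0\<^sub>v k" "\<And>j. j \<in> S \<Longrightarrow> codeword G m $ j = 0"
    using exists_nonzero_message_vanishing_on[OF G S] by blast
  have "codeword G (0\<^sub>v k) $ j = 0" if "j \<in> S" for j
    using that S G by (auto simp: codeword_def)
  with m(3) have same: "erasure_output S (codeword G m) = erasure_output S (codeword G (0\<^sub>v k))"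
    by (auto simp: erasure_output_def)
  have "AE r in R. dec r (erasure_output S (codeword G m)) = Some m"
    and "AE r in R. dec r (erasure_output S (codeword G (0\<^sub>v k))) = Some (0\<^sub>v k)"
    using dec m(1) G by (auto simp: decodable_def)
  \<comment> \<open>For almost every r the same output would have to decode to two different
    messages.\<close>
  then have "AE r in R. False"
    by eventually_elim (use same m(2) in auto)
  then show False
    by simp
qed

section \<open>Erasure patterns: counting and probabilities\<close>

lemma failure_prob_eq_card:
  assumes "G \<in> carrier_mat k n" "i \<le> n"
  shows "failure_prob R dec G i =
    real (card {E. E \<subseteq> {..<n} \<and> card E = i \<and> \<not> decodable R dec G ({..<n} - E)}) / real (n choose i)"
proof -
  let ?P = "{E. E \<subseteq> {..<n} \<and> card E = i}"
  have c: "card ?P = n choose i"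
    using n_subsets[of "{..<n}" i] by simp
  \<comment> \<open>\<open>pmf_of_set\<close> is the uniform distribution only on a nonempty finite
    set; this is where \<open>i \<le> n\<close> enters.\<close>
  have "?P \<noteq> {}"
    using assms by (auto intro!: exI[of _ "{..<i}"])
  then have "failure_prob R dec G i =
      card (?P \<inter> {E. \<not> decodable R dec G ({..<n} - E)}) / card ?P"
    using assms unfolding failure_prob_def by (subst measure_pmf_of_set) auto
  also have "?P \<inter> {E. \<not> decodable R dec G ({..<n} - E)} =
      {E. E \<subseteq> {..<n} \<and> card E = i \<and> \<not> decodable R dec G ({..<n} - E)}"
    by auto
  finally show ?thesis
    by (simp add: c)
qed

text \<open>Fixing the exact set of finished servers puts one half-line condition on each variable,
  so independence gives a product: a factor q for each member of \<open>E\<close>, and 1 - q for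
  every other index.\<close>

lemma (in prob_space) prob_sublevel_eq:
  fixes X :: "'i \<Rightarrow> 'a \<Rightarrow> real"
  assumes indep: "indep_vars (\<lambda>_. borel) X I" and I: "finite I" "I \<noteq> {}" "E \<subseteq> I"
    and q: "\<And>j. j \<in> I \<Longrightarrow> prob {\<omega> \<in> space M. X j \<omega> \<le> t} = 1 - q"
  shows "prob {\<omega> \<in> space M. {j \<in> I. X j \<omega> \<le> t} = I - E} = q ^ card E * (1 - q) ^ (card I - card E)"
proof -
  have meas[measurable]: "X j \<in> borel_measurable M" if "j \<in> I" for j
    using indep that by (auto simp: indep_vars_def)
  define A where "A j = (if j \<in> E then {t<..} else {..t})" for j
  have "{\<omega> \<in> space M. {j \<in> I. X j \<omega> \<le> t} = I - E} = (\<Inter>j\<in>I. X j -` A j \<inter> space M)"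
    using I by (fastforce simp: A_def split: if_splits)
  then have "prob {\<omega> \<in> space M. {j \<in> I. X j \<omega> \<le> t} = I - E} = (\<Prod>j\<in>I. prob (X j -` A j \<inter> space M))"
    using indep_varsD[OF indep \<open>I \<noteq> {}\<close> \<open>finite I\<close> subset_refl, of A] by (simp add: A_def)
  also have "\<dots> = (\<Prod>j\<in>I. if j \<in> E then q else 1 - q)"
  proof (rule prod.cong[OF refl])
    fix j assume j: "j \<in> I"
    note [measurable] = meas[OF j]
    have *: "X j -` {..t} \<inter> space M = {\<omega> \<in> space M. X j \<omega> \<le> t}"
      by auto
    have "X j -` {t<..} \<inter> space M = space M - {\<omega> \<in> space M. X j \<omega> \<le> t}"
      by auto
    then have "prob (X j -` {t<..} \<inter> space M) = 1 - prob {\<omega> \<in> space M. X j \<omega> \<le> t}"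
      by (simp add: prob_compl)
    with q[OF j] * show "prob (X j -` A j \<inter> space M) = (if j \<in> E then q else 1 - q)"
      by (simp add: A_def)
  qed
  also have "\<dots> = q ^ card (I \<inter> E) * (1 - q) ^ card (I - E)"
    using I by (simp add: prod.If_cases Diff_eq)
  also have "I \<inter> E = E"
    using I by auto
  also have "card (I - E) = card I - card E"
    using I by (simp add: card_Diff_subset finite_subset)
  finally show ?thesis .
qed

text \<open>Each \<open>E\<close> contributes one Beta integral, with exponents
  \<open>card E\<close> and \<open>n - card E\<close>. The bound \<open>1 \<le> card E\<close> is
  essential: an empty \<open>E\<close> would give an integrand tending to 1 and hence a divergent
  integral.\<close>

lemma (in prob_space) nn_integral_of_exponential_tail:
  fixes Y :: "'a \<Rightarrow> real"
  assumes Y: "Y \<in> borel_measurable M" and B: "finite B"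
    and E: "\<And>E. E \<in> B \<Longrightarrow> 1 \<le> card E \<and> card E \<le> n"
    and tail: "\<And>u. 0 \<le> u \<Longrightarrow> prob {\<omega> \<in> space M. u < Y \<omega>} =
      (\<Sum>E\<in>B. exp (- u) ^ card E * (1 - exp (- u)) ^ (n - card E))"
  shows "(\<integral>\<^sup>+ \<omega>. ennreal (Y \<omega>) \<partial>M) =
    ennreal (\<Sum>E\<in>B. fact (card E - 1) * fact (n - card E) / fact n)"
proof -
  let ?f = "\<lambda>u. \<Sum>E\<in>B. indicator {0..} u * (exp (- u) ^ card E * (1 - exp (- u)) ^ (n - card E)) :: real"
  have "has_bochner_integral lborel ?f (\<Sum>E\<in>B. fact (card E - 1) * fact (n - card E) / fact n)"
  proof (rule has_bochner_integral_sum)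
    fix E assume "E \<in> B"
    then have "1 \<le> card E" "card E \<le> n"
      using E by auto
    then show "has_bochner_integral lborel
        (\<lambda>u. indicator {0..} u * (exp (- u) ^ card E * (1 - exp (- u)) ^ (n - card E)))
        (fact (card E - 1) * fact (n - card E) / fact n :: real)"
      using has_bochner_integral_exp_times_one_minus_exp_power[of "card E - 1" "n - card E"]
      by (simp del: power_Suc fact_Suc)
  qed
  moreover have "0 \<le> ?f u" for u
    by (intro sum_nonneg) (auto split: split_indicator)
  ultimately have "(\<integral>\<^sup>+ u. ennreal (?f u) \<partial>lborel) =
      ennreal (\<Sum>E\<in>B. fact (card E - 1) * fact (n - card E) / fact n)"
    by (simp add: has_bochner_integral_iff nn_integral_eq_integral)
  moreover have "indicator {0..} u * emeasure M {\<omega> \<in> space M. u < Y \<omega>} = ennreal (?f u)" for u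
    using tail[of u] by (auto simp: emeasure_eq_measure split: split_indicator)
  ultimately show ?thesis
    using nn_integral_eq_nn_integral_tail[OF Y] by simp
qed

text \<open>The binomial in this form of the Beta value turns the number of failing patterns of size
  i into the failure probability.\<close>

lemma fact_mult_fact_div_fact:
  assumes "1 \<le> i" "i \<le> n"
  shows "(fact (i - 1) * fact (n - i) / fact n :: real) = 1 / (real i * real (n choose i))"
proof -
  have "(fact i :: real) = real i * fact (i - 1)"
    using assms by (simp add: fact_reduce)
  then show ?thesis
    using assms by (simp add: binomial_fact field_simps)
qed

section \<open>The average execution time\<close>

theorem theorem2:
  fixes n k :: nat and \<mu> :: real
    and G :: "'f :: field mat"
    and R :: "'r measure" and dec :: "('r, 'f) decoder"
    and M :: "'a measure" and X :: "nat \<Rightarrow> 'a \<Rightarrow> real"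
  assumes "1 \<le> k" and "k \<le> n" and "0 < \<mu>"
    and "G \<in> carrier_mat k n" and "vec_space.rank k G = k"
    and "prob_space R"
    and "decodable R dec G {..<n}"
    and "\<And>S S'. \<lbrakk>S \<subseteq> S'; S' \<subseteq> {..<n}; decodable R dec G S\<rbrakk> \<Longrightarrow> decodable R dec G S'"
    and "prob_space M"
    and "prob_space.indep_vars M (\<lambda>_. borel) X {..<n}"
    and "\<And>j t. j < n \<Longrightarrow>
           measure M {\<omega> \<in> space M. X j \<omega> \<le> t} =
             (if t < 1 / real k then 0 else 1 - exp (- \<mu> * (real k * t - 1)))"
  shows "prob_space.expectation M (completion_time R dec G X) =
           1 / real k * (1 + (\<Sum>i = n - k + 1..n. 1 / (real i * \<mu>)))
           + 1 / (\<mu> * real k) * (\<Sum>i = 1..n - k. 1 / real i * failure_prob R dec G i)"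
proof -
  interpret M: prob_space M by fact
  note G = \<open>G \<in> carrier_mat k n\<close>
  have n: "dim_col G = n" "0 < n" and k: "0 < k"
    using assms by auto
  let ?D = "decodable R dec G"
  let ?p = "failure_prob R dec G"
  define T where "T = completion_time R dec G X"
  \<comment> \<open>The erasure patterns that make decoding fail; the tail of \<open>T\<close> is
    decomposed over them.\<close>
  define B where "B = {E. E \<subseteq> {..<n} \<and> \<not> ?D ({..<n} - E)}"
  have meas[measurable]: "X j \<in> borel_measurable M" if "j < n" for j
    using assms(10) that by (auto simp: M.indep_vars_def)
  have D0: "\<not> ?D {}"
    using not_decodable_if_card_less[OF \<open>prob_space R\<close> G, of "{}"] k by simp
  have T_le: "T \<omega> \<le> t \<longleftrightarrow> ?D {j \<in> {..<n}. X j \<omega> \<le> t}" for \<omega> t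
    unfolding T_def completion_time_def n
    by (rule Least_le_iff_sublevel[where D = ?D, OF finite_lessThan assms(7) D0 assms(8)])
  \<comment> \<open>Measurability follows by rewriting the set equation as finitely many conditions
    on single run times.\<close>
  have pattern_sets: "{\<omega> \<in> space M. {j \<in> {..<n}. X j \<omega> \<le> t} = {..<n} - E} \<in> sets M" for t E
  proof -
    have "{\<omega> \<in> space M. {j \<in> {..<n}. X j \<omega> \<le> t} = {..<n} - E} =
        {\<omega> \<in> space M. \<forall>j\<in>{..<n}. X j \<omega> \<le> t \<longleftrightarrow> j \<notin> E}"
      by (auto simp: set_eq_iff)
    also have "\<dots> \<in> sets M"
      by measurable
    finally show ?thesis .
  qed
  have "finite B"
    by (rule finite_subset[of _ "Pow {..<n}"]) (auto simp: B_def)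
  have T_gt: "{\<omega> \<in> space M. t < T \<omega>} =
      (\<Union>E\<in>B. {\<omega> \<in> space M. {j \<in> {..<n}. X j \<omega> \<le> t} = {..<n} - E})" for t
  proof -
    have "t < T \<omega> \<longleftrightarrow> (\<exists>E\<in>B. {j \<in> {..<n}. X j \<omega> \<le> t} = {..<n} - E)" for \<omega>
    proof
      assume "t < T \<omega>"
      then have "\<not> ?D {j \<in> {..<n}. X j \<omega> \<le> t}"
        using T_le[of \<omega> t] by linarith
      moreover have "{j \<in> {..<n}. X j \<omega> \<le> t} = {..<n} - {j \<in> {..<n}. t < X j \<omega>}"
        by auto
      ultimately show "\<exists>E\<in>B. {j \<in> {..<n}. X j \<omega> \<le> t} = {..<n} - E"
        unfolding B_def by (intro bexI[of _ "{j \<in> {..<n}. t < X j \<omega>}"]) auto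
    next
      assume "\<exists>E\<in>B. {j \<in> {..<n}. X j \<omega> \<le> t} = {..<n} - E"
      then have "\<not> ?D {j \<in> {..<n}. X j \<omega> \<le> t}"
        by (auto simp: B_def)
      then show "t < T \<omega>"
        using T_le[of \<omega> t] by linarith
    qed
    then show ?thesis
      by auto
  qed
  have T_meas[measurable]: "T \<in> borel_measurable M"
    unfolding borel_measurable_iff_greater T_gt
    using \<open>finite B\<close> pattern_sets by (auto intro!: sets.finite_UN)
  \<comment> \<open>The empty pattern is not in \<open>B\<close>, since decoding succeeds without
    erasures.\<close>
  have card_B: "1 \<le> card E \<and> card E \<le> n" if "E \<in> B" for E
  proof -
    have "E \<noteq> {}" "E \<subseteq> {..<n}"
      using that assms(7) by (auto simp: B_def)
    then show ?thesis
      using card_mono[of "{..<n}" E] finite_subset[of E "{..<n}"]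
      by (auto simp: Suc_le_eq card_gt_0_iff)
  qed

  \<comment> \<open>The normalisation turns the run times into standard exponential variables.\<close>
  define Y where "Y \<omega> = \<mu> * (real k * T \<omega> - 1)" for \<omega>
  have Y_meas[measurable]: "Y \<in> borel_measurable M"
    unfolding Y_def by measurable
  have Y_tail: "M.prob {\<omega> \<in> space M. u < Y \<omega>} =
      (\<Sum>E\<in>B. exp (- u) ^ card E * (1 - exp (- u)) ^ (n - card E))" if u: "0 \<le> u" for u
  proof -
    \<comment> \<open>The solution of \<mu> (k t - 1) = u. For u \<ge> 0 it lies in the exponential
      branch of the distribution function, so each server is still running at t with probability exp
      (- u).\<close>
    define t where "t = (1 + u / \<mu>) / real k"
    have t: "1 / real k \<le> t" "\<mu> * (real k * t - 1) = u"
      using u k \<open>0 < \<mu>\<close> by (auto simp: t_def field_simps)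
    have "u < Y \<omega> \<longleftrightarrow> t < T \<omega>" for \<omega>
      using k \<open>0 < \<mu>\<close> by (simp add: Y_def t_def field_simps)
    \<comment> \<open>Additivity applies because distinct subsets of \<open>{..<n}\<close> have
      distinct complements, so the pattern events are disjoint.\<close>
    then have "M.prob {\<omega> \<in> space M. u < Y \<omega>} =
        (\<Sum>E\<in>B. M.prob {\<omega> \<in> space M. {j \<in> {..<n}. X j \<omega> \<le> t} = {..<n} - E})"
      unfolding T_gt[symmetric, of t]
      using \<open>finite B\<close> pattern_sets
      by (simp add: T_gt, intro M.finite_measure_finite_Union)
         (auto simp: disjoint_family_on_def B_def)
    also have "\<dots> = (\<Sum>E\<in>B. exp (- u) ^ card E * (1 - exp (- u)) ^ (n - card E))"
    proof (rule sum.cong[OF refl])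
      fix E assume "E \<in> B"
      then show "M.prob {\<omega> \<in> space M. {j \<in> {..<n}. X j \<omega> \<le> t} = {..<n} - E} =
          exp (- u) ^ card E * (1 - exp (- u)) ^ (n - card E)"
        using M.prob_sublevel_eq[OF assms(10), of E t "exp (- u)"] assms(11)[of _ t] n t
        by (auto simp: B_def)
    qed
    finally show ?thesis .
  qed
  \<comment> \<open>The distribution function vanishes at 1/k itself, which gives the strict
    inequality: almost surely nothing is finished at time 1/k, and the empty set is not
    decodable.\<close>
  have "AE \<omega> in M. \<forall>j\<in>{..<n}. 1 / real k < X j \<omega>"
  proof (rule AE_finite_allI)
    fix j assume "j \<in> {..<n}"
    then have j[simp]: "j < n" by simp
    have "M.prob {\<omega> \<in> space M. X j \<omega> \<le> 1 / real k} = 0"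
      using assms(11)[OF j, of "1 / real k"] k by simp
    then have "AE \<omega> in M. \<not> X j \<omega> \<le> 1 / real k"
      by (subst (asm) M.prob_eq_0) auto
    then show "AE \<omega> in M. 1 / real k < X j \<omega>"
      by (simp add: not_le)
  qed simp
  then have Y_nonneg: "AE \<omega> in M. 0 \<le> Y \<omega>"
  proof eventually_elim
    case (elim \<omega>)
    then have "{j \<in> {..<n}. X j \<omega> \<le> 1 / real k} = {}"
      by (auto simp: not_le)
    then have "1 / real k < T \<omega>"
      using T_le[of \<omega> "1 / real k"] D0 by (metis not_le)
    then show "0 \<le> Y \<omega>"
      using k \<open>0 < \<mu>\<close> by (simp add: Y_def field_simps)
  qed
  let ?s = "\<Sum>E\<in>B. fact (card E - 1) * fact (n - card E) / fact n :: real"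
  have "(\<integral>\<^sup>+ \<omega>. ennreal (Y \<omega>) \<partial>M) = ennreal ?s"
    by (rule M.nn_integral_of_exponential_tail[OF Y_meas \<open>finite B\<close> card_B Y_tail])
  \<comment> \<open>Almost sure nonnegativity lets the extended nonnegative integral, which
    truncates \<open>Y\<close> at 0, determine the expectation.\<close>
  then have Y_int: "has_bochner_integral M Y ?s"
    using Y_nonneg by (intro has_bochner_integral_nn_integral sum_nonneg) auto
  \<comment> \<open>Patterns are grouped by size; \<open>card_B\<close> keeps all sizes within
    1..n.\<close>
  have "?s = (\<Sum>i = 1..n. \<Sum>E | E \<in> B \<and> card E = i. fact (card E - 1) * fact (n - card E) / fact n)"
    by (rule sum.group[symmetric]) (use \<open>finite B\<close> card_B in auto)
  also have "\<dots> = (\<Sum>i = 1..n. 1 / real i * ?p i)"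
  proof (rule sum.cong[OF refl])
    fix i assume i: "i \<in> {1..n}"
    have "{E \<in> B. card E = i} = {E. E \<subseteq> {..<n} \<and> card E = i \<and> \<not> ?D ({..<n} - E)}"
      by (auto simp: B_def)
    then show "(\<Sum>E | E \<in> B \<and> card E = i. fact (card E - 1) * fact (n - card E) / fact n) =
        1 / real i * ?p i"
      using i fact_mult_fact_div_fact[of i n] failure_prob_eq_card[OF G, of i R dec] by simp
  qed
  also have "{1..n} = {1..n - k} \<union> {n - k + 1..n}"
    using \<open>k \<le> n\<close> by auto
  also have "(\<Sum>i \<in> {1..n - k} \<union> {n - k + 1..n}. 1 / real i * ?p i) =
      (\<Sum>i = 1..n - k. 1 / real i * ?p i) + (\<Sum>i = n - k + 1..n. 1 / real i * ?p i)"
    by (rule sum.union_disjoint) auto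
  \<comment> \<open>More than n - k erasures leave fewer than k symbols, so every pattern of such a
    size fails.\<close>
  also have "(\<Sum>i = n - k + 1..n. 1 / real i * ?p i) = (\<Sum>i = n - k + 1..n. 1 / real i)"
  proof (rule sum.cong[OF refl])
    fix i assume i: "i \<in> {n - k + 1..n}"
    have "\<not> ?D ({..<n} - E)" if "E \<subseteq> {..<n}" "card E = i" for E
      using i that \<open>k \<le> n\<close>
      by (intro not_decodable_if_card_less[OF \<open>prob_space R\<close> G])
         (auto simp: card_Diff_subset finite_subset)
    then have "{E. E \<subseteq> {..<n} \<and> card E = i \<and> \<not> ?D ({..<n} - E)} = {E. E \<subseteq> {..<n} \<and> card E = i}"
      by auto
    then have "?p i = 1"
      using i failure_prob_eq_card[OF G, of i R dec] n_subsets[of "{..<n}" i] by simp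
    then show "1 / real i * ?p i = 1 / real i"
      by simp
  qed
  finally have s: "?s = (\<Sum>i = 1..n - k. 1 / real i * ?p i) + (\<Sum>i = n - k + 1..n. 1 / real i)" .
  \<comment> \<open>Inverting the normalisation; the constant 1/k integrates to itself over a
    probability space.\<close>
  have "T = (\<lambda>\<omega>. 1 / real k + 1 / (\<mu> * real k) * Y \<omega>)"
    using k \<open>0 < \<mu>\<close> by (auto simp: Y_def field_simps)
  then have T: "M.expectation T = 1 / real k + 1 / (\<mu> * real k) * ?s"
    using Y_int by (simp add: has_bochner_integral_iff M.prob_space del: times_divide_eq_left)
  have sum_eq: "(\<Sum>i = n - k + 1..n. 1 / (real i * \<mu>)) = 1 / \<mu> * (\<Sum>i = n - k + 1..n. 1 / real i)"
    by (simp add: sum_divide_distrib)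
  show ?thesis
    unfolding T_def[symmetric] T s sum_eq by (simp add: distrib_left mult.commute add.commute)
qed

end
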